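(* Let $G$ be a graph on $n$ vertices, let $H$ be a spanning supergraph of $G$, and suppose $A\in\mathcal{S}(G)$ has the strong spectral property (SSP). Then for every $\varepsilon>0$ and every assignment of signs $\sigma: E(H)\setminus E(G)\to\{+,-\}$ there is a matrix $A'\in\mathcal{S}(H)$ such that $\operatorname{spec}(A')=\operatorname{spec}(A)$, $A'$ has the SSP, $\|A'-A\|<\varepsilon$, the entry of $A'$ corresponding to each $e\in E(H)\setminus E(G)$ has sign $\sigma(e)$, and every other off-diagonal entry of $A'$ has the same sign (positive, negative, or zero) as the corresponding entry of $A$.
   Context: All graphs are simple, finite and undirected. For a graph $G$ on $n$ vertices, $\mathcal{S}(G)$ is the set of $n\times n$ real symmetric matrices (rows and columns indexed by $V(G)$) whose off-diagonal $i,j$-entry is nonzero if and only if $\{i,j\}$ is an edge of $G$; diagonal entries are arbitrary real numbers. $\operatorname{spec}(A)$ is the multiset of eigenvalues of $A$. $H$ is a spanning supergraph of $G$ if $V(H)=V(G)$ and $E(G)\subseteq E(H)$. A real symmetric matrix $A$ has the strong spectral property (SSP) if $X=O$ is the only real symmetric matrix with $A\circ X=O$, $I\circ X=O$ and $AX-XA=O$, where $\circ$ is the entrywise product. $\|\cdot\|$ is any fixed matrix norm. *)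

theory Defs
  imports "HOL-Analysis.Analysis" "HOL-Computational_Algebra.Polynomial"
begin

(* A simple graph with vertex set UNIV :: 'n set is given by its edge set, a set of
   two-element subsets of 'n; finiteness of 'n makes it finite. *)

definition simple_graph :: "'n::finite set set \<Rightarrow> bool" where
  "simple_graph G \<longleftrightarrow> (\<forall>e\<in>G. card e = 2)"

(* The vertex sets coincide because G and H share the vertex type. *)

definition spanning_supergraph :: "'n::finite set set \<Rightarrow> 'n set set \<Rightarrow> bool" where
  "spanning_supergraph H G \<longleftrightarrow> simple_graph G \<and> simple_graph H \<and> G \<subseteq> H"

definition symmetric_matrix :: "real^'n^'n \<Rightarrow> bool" where
  "symmetric_matrix A \<longleftrightarrow> transpose A = A"

definition graph_matrices :: "'n::finite set set \<Rightarrow> (real^'n^'n) set" where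
  "graph_matrices G =
    {A. symmetric_matrix A \<and> (\<forall>i j. i \<noteq> j \<longrightarrow> (A $ i $ j \<noteq> 0 \<longleftrightarrow> {i, j} \<in> G))}"

definition charpoly :: "real^'n^'n \<Rightarrow> real poly" where
  "charpoly A = det (mat [:0, 1:] - (\<chi> i j. [:A $ i $ j:]))"

(* Eigenvalues with multiplicity. Only real roots are collected, which for a symmetric
   matrix are all roots of the characteristic polynomial. *)

definition spec :: "real^'n^'n \<Rightarrow> real multiset" where
  "spec A = proots (charpoly A)"

(* On the type real^'n^'n the operation * is the entrywise product and ** is the matrix
   product; the identity matrix is mat 1 (not 1, which is the all-ones matrix). *)

definition strong_spectral_property :: "real^'n^'n \<Rightarrow> bool" where
  "strong_spectral_property A \<longleftrightarrow>
    symmetric_matrix A \<and>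
    (\<forall>X :: real^'n^'n. symmetric_matrix X \<and> A * X = 0 \<and> mat 1 * X = 0 \<and>
       A ** X - X ** A = 0 \<longrightarrow> X = 0)"

(* Submultiplicativity is not required, so that every common convention for
   "matrix norm" is covered. *)

definition matrix_norm :: "(real^'n^'n \<Rightarrow> real) \<Rightarrow> bool" where
  "matrix_norm N \<longleftrightarrow>
    (\<forall>X. 0 \<le> N X) \<and> (\<forall>X. N X = 0 \<longleftrightarrow> X = 0) \<and>
    (\<forall>c X. N (c *\<^sub>R X) = \<bar>c\<bar> * N X) \<and> (\<forall>X Y. N (X + Y) \<le> N X + N Y)"

end

theory Submission
  imports Defs
begin

text \<open>
  The idea is to move \<open>A\<close> inside its orbit under orthogonal similarity, which keeps the
  spectrum, and to use that SSP makes this orbit transversal to the space of symmetric matrices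
  that vanish off the diagonal wherever \<open>A\<close> does. The tangent space of the orbit at \<open>A\<close> is
  \<open>{A ** K - K ** A | K skew}\<close>. A symmetric \<open>X\<close> orthogonal to it commutes with
  \<open>A\<close>, and one orthogonal to that space vanishes on the diagonal and wherever \<open>A\<close> does
  not. Thus SSP says precisely that
  the two spaces together span all symmetric matrices
  (\<open>SSP_commutator_plus_pattern_surj\<close>).

  To pass from tangent vectors to matrices, orthogonal matrices are parametrised by the Cayley
  transform \<open>(1 + K)(1 - K)\<inverse>\<close> with \<open>K\<close> skew. Writing
  \<open>A = (1 + K) C (1 - K)\<close>, the similar matrix is \<open>A' = (1 - K) C (1 + K)\<close>. With \<open>C\<close>
  as an additional unknown no inverse occurs: both right-hand sides are polynomial in
  \<open>(K, C)\<close>. The system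
  \<open>(1 + K) C (1 - K) = A\<close>, \<open>(1 - K) C (1 + K) + P B = A + T\<close>, where the
  symmetric values of the linear map \<open>P\<close> vanish at the off-diagonal zeros of \<open>A\<close>, has the
  solution \<open>(K, C, B) = (0, A, 0)\<close> for \<open>T = 0\<close>, and its derivative
  there is onto. The open mapping theorem for maps whose derivative at a point is onto then solves
  it for every small symmetric \<open>T\<close>, with \<open>A'\<close> as close to \<open>A\<close> as
  desired; at the off-diagonal zeros of \<open>A\<close> the entries of \<open>A'\<close> are those of \<open>T\<close>
  (\<open>SSP_isospectral_perturbation\<close>).

  The theorem follows on choosing for \<open>T\<close> a small multiple of the sign matrix. Nonzero
  entries of \<open>A\<close> keep their sign under small perturbations
  (\<open>sgn_entries_stable\<close>), and SSP survives them as well, since it is injectivity of the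
  linear map \<open>X \<mapsto> A ** X - X ** A\<close> on a subspace that cannot grow (\<open>SSP_open\<close>).
\<close>

section \<open>Matrix multiplication, transposes and inner products\<close>

lemma bounded_bilinear_matrix_matrix_mult:
  "bounded_bilinear ((**) :: real^'n^'m \<Rightarrow> real^'p^'n \<Rightarrow> real^'p^'m)"
  unfolding bilinear_conv_bounded_bilinear[symmetric] bilinear_def linear_iff
  by (auto simp: matrix_add_ldistrib vec_eq_iff matrix_matrix_mult_def algebra_simps sum.distrib sum_distrib_left)

lemmas continuous_on_matrix_matrix_mult [continuous_intros] =
  bounded_bilinear.continuous_on [OF bounded_bilinear_matrix_matrix_mult]

lemmas has_derivative_matrix_matrix_mult [derivative_intros] =
  bounded_bilinear.FDERIV [OF bounded_bilinear_matrix_matrix_mult]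

text \<open>
  For the entrywise inner product, multiplication by a matrix is adjoint to multiplication by its
  transpose. This turns orthogonality to commutators with \<open>A\<close> into a commutation relation.
\<close>
lemma inner_matrix_mult_right:
  fixes X :: "real^'p^'m" and A :: "real^'n^'m" and B :: "real^'p^'n"
  shows "X \<bullet> (A ** B) = (transpose A ** X) \<bullet> B"
proof -
  have "X \<bullet> (A ** B) = (\<Sum>i\<in>UNIV. \<Sum>j\<in>UNIV. \<Sum>k\<in>UNIV. A$i$k * X$i$j * B$k$j)"
    by (simp add: inner_vec_def matrix_matrix_mult_def sum_distrib_left mult_ac)
  also have "\<dots> = (\<Sum>k\<in>UNIV. \<Sum>j\<in>UNIV. \<Sum>i\<in>UNIV. A$i$k * X$i$j * B$k$j)"
    by (subst (2) sum.swap, subst sum.swap, subst (2) sum.swap, simp)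
  also have "\<dots> = (transpose A ** X) \<bullet> B"
    by (simp add: inner_vec_def matrix_matrix_mult_def transpose_def sum_distrib_right)
  finally show ?thesis .
qed

lemma inner_transpose_transpose:
  fixes A B :: "real^'n^'m"
  shows "transpose A \<bullet> transpose B = A \<bullet> B"
  by (simp add: inner_vec_def transpose_def) (rule sum.swap)

lemma inner_matrix_mult_left:
  fixes X :: "real^'p^'m" and A :: "real^'p^'n" and B :: "real^'n^'m"
  shows "X \<bullet> (B ** A) = (X ** transpose A) \<bullet> B"
proof -
  have "X \<bullet> (B ** A) = transpose X \<bullet> (transpose A ** transpose B)"
    by (metis inner_transpose_transpose matrix_transpose_mul)
  also have "\<dots> = transpose (X ** transpose A) \<bullet> transpose B"
    by (simp add: inner_matrix_mult_right matrix_transpose_mul)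
  finally show ?thesis
    by (simp only: inner_transpose_transpose)
qed

lemma transpose_add: "transpose (A + B :: real^'n^'m) = transpose A + transpose B"
  by (simp add: vec_eq_iff transpose_def)

lemma transpose_diff: "transpose (A - B :: real^'n^'m) = transpose A - transpose B"
  by (simp add: vec_eq_iff transpose_def)

lemma transpose_minus: "transpose (- A :: real^'n^'m) = - transpose A"
  by (simp add: vec_eq_iff transpose_def)

section \<open>The strong spectral property as transversality\<close>

text \<open>
  Every skew-symmetric matrix is \<open>antisymmetrize L\<close> for some \<open>L\<close>. Using \<open>L\<close> as the
  variable makes the domain of the maps below a full matrix space, hence a Euclidean space.
\<close>
definition antisymmetrize :: "real^'n^'n \<Rightarrow> real^'n^'n" where
  "antisymmetrize L = L - transpose L"

lemma linear_antisymmetrize: "linear antisymmetrize"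
  by (rule linearI) (simp_all add: antisymmetrize_def vec_eq_iff transpose_def algebra_simps)

lemma transpose_antisymmetrize: "transpose (antisymmetrize L) = - antisymmetrize L"
  by (simp add: antisymmetrize_def vec_eq_iff transpose_def)

lemma antisymmetrize_skew: "transpose K = - K \<Longrightarrow> antisymmetrize K = 2 *\<^sub>R K"
  by (simp add: antisymmetrize_def scaleR_2)

text \<open>
  For symmetric \<open>A\<close>, the values of this map are the matrices that are antisymmetric on the
  zero entries of \<open>A\<close> off the diagonal, and arbitrary elsewhere. Keeping the antisymmetric
  part is what allows surjectivity onto all matrices instead of only onto the
  symmetric ones. When the result is symmetric, nothing remains on those zero entries.
\<close>
definition pattern_part :: "real^'n^'n \<Rightarrow> real^'n^'n \<Rightarrow> real^'n^'n" where
  "pattern_part A B =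
    (\<chi> i j. if i = j \<or> A $ i $ j \<noteq> 0 then B $ i $ j else B $ i $ j - B $ j $ i)"

lemma linear_pattern_part: "linear (pattern_part A)"
  by (rule linearI) (simp_all add: pattern_part_def vec_eq_iff algebra_simps)

lemma symmetric_pattern_part_zero:
  assumes "symmetric_matrix A" "symmetric_matrix (pattern_part A B)" "i \<noteq> j" "A $ i $ j = 0"
  shows "pattern_part A B $ i $ j = 0"
proof -
  have "A $ j $ i = 0" "pattern_part A B $ i $ j = pattern_part A B $ j $ i"
    using assms by (auto simp: symmetric_matrix_def vec_eq_iff transpose_def)
  then show ?thesis
    using assms by (auto simp: pattern_part_def)
qed

text \<open>
  A matrix orthogonal to the range is symmetric with zero diagonal and zero entries where \<open>A\<close> is
  nonzero, because it is orthogonal to the pattern parts; and it commutes with \<open>A\<close>, because it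
  is orthogonal to the commutators. SSP leaves only zero.
\<close>
lemma SSP_commutator_plus_pattern_surj:
  fixes A :: "real^'n^'n"
  assumes "strong_spectral_property A"
  shows "\<exists>L B. A ** antisymmetrize L - antisymmetrize L ** A + pattern_part A B = Y"
proof -
  interpret mm: bounded_bilinear "(**) :: real^'n^'n \<Rightarrow> real^'n^'n \<Rightarrow> real^'n^'n"
    by (rule bounded_bilinear_matrix_matrix_mult)
  define D where "D = (\<lambda>p. A ** antisymmetrize (fst p) - antisymmetrize (fst p) ** A + pattern_part A (snd p))"
  have "linear D"
    by (rule linearI)
      (simp_all add: D_def linear_add[OF linear_antisymmetrize] linear_scale[OF linear_antisymmetrize]
        linear_add[OF linear_pattern_part] linear_scale[OF linear_pattern_part]
        mm.add_left mm.add_right mm.scaleR_left mm.scaleR_right algebra_simps)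
  have symA: "transpose A = A"
    using assms by (simp add: strong_spectral_property_def symmetric_matrix_def)
  then have symA_entry: "A $ j $ i = A $ i $ j" for i j
    by (simp add: vec_eq_iff transpose_def)
  have "range D = UNIV"
  proof (rule ccontr)
    assume "range D \<noteq> UNIV"
    moreover have sub: "span (range D) = range D"
      using \<open>linear D\<close> by (simp add: linear_subspace_image span_eq_iff)
    ultimately have "span (range D) \<subset> span UNIV"
      by (metis span_UNIV top.not_eq_extremum)
    then obtain X where "X \<noteq> 0" and orth: "\<And>Y. Y \<in> span (range D) \<Longrightarrow> orthogonal X Y"
      using orthogonal_to_subspace_exists_gen[of "range D" UNIV] by blast
    have ortho: "X \<bullet> D p = 0" for p
      using orth[of "D p"] by (simp add: sub orthogonal_def)
    have orth_pat: "X \<bullet> pattern_part A B = 0" for B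
      using ortho[of "(0, B)"] by (simp add: D_def linear_0[OF linear_antisymmetrize])
    have orth_com: "X \<bullet> (A ** antisymmetrize L - antisymmetrize L ** A) = 0" for L
      using ortho[of "(L, 0)"] by (simp add: D_def linear_0[OF linear_pattern_part])
    have entry: "X \<bullet> axis i (axis j (c::real)) = c * X $ i $ j" for i j c
      by (simp add: inner_axis)
    have X0: "X $ i $ j = 0" if "i = j \<or> A $ i $ j \<noteq> 0" for i j
    proof -
      from symA_entry have "pattern_part A (axis i (axis j 1)) = axis i (axis j 1)"
        using that by (auto simp: pattern_part_def vec_eq_iff axis_def)
      then show ?thesis
        using orth_pat[of "axis i (axis j 1)"] by (simp add: entry)
    qed
    have Xsym: "X $ i $ j = X $ j $ i" for i j
    proof (cases "i = j \<or> A $ i $ j \<noteq> 0")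
      case True
      then show ?thesis
        using X0 symA_entry by metis
    next
      case False
      with symA_entry have "pattern_part A (axis i (axis j 1)) = axis i (axis j 1) - axis j (axis i 1)"
        by (auto simp: pattern_part_def vec_eq_iff axis_def)
      then show ?thesis
        using orth_pat[of "axis i (axis j 1)"] by (simp add: inner_diff_right entry)
    qed
    then have transX: "transpose X = X"
      by (simp add: vec_eq_iff transpose_def)
    \<comment> \<open>The commutator \<open>K\<close> is skew itself, so testing \<open>X\<close> against the direction
        \<open>K\<close> produces \<open>K \<bullet> K\<close>.\<close>
    define K where "K = A ** X - X ** A"
    have "transpose K = - K"
      by (simp add: K_def transpose_diff matrix_transpose_mul symA transX)
    have "X \<bullet> (A ** antisymmetrize K - antisymmetrize K ** A) = K \<bullet> antisymmetrize K"
      using inner_matrix_mult_right[of X A "antisymmetrize K"] inner_matrix_mult_left[of X "antisymmetrize K" A]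
      by (simp add: inner_diff_right inner_diff_left symA K_def[symmetric]) (simp add: K_def inner_diff_left)
    then have "2 * (K \<bullet> K) = 0"
      using orth_com[of K] \<open>transpose K = - K\<close> by (simp add: antisymmetrize_skew)
    then have "A ** X - X ** A = 0"
      by (simp add: K_def)
    moreover have "A * X = 0" "mat 1 * X = 0"
      using X0 by (auto simp: vec_eq_iff mat_def)
    ultimately have "X = 0"
      using assms transX unfolding strong_spectral_property_def symmetric_matrix_def by blast
    with \<open>X \<noteq> 0\<close> show False ..
  qed
  then obtain p where "D p = Y"
    by (metis UNIV_I imageE)
  then show ?thesis
    unfolding D_def by blast
qed

section \<open>Similarity by Cayley transforms\<close>

text \<open>
  The characteristic matrices satisfy \<open>(x - P B) P = P (x - B P)\<close> over the polynomial ring, and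
  the constant \<open>det P\<close> can be cancelled.
\<close>
lemma charpoly_mult_commute:
  fixes P B :: "real^'n^'n"
  assumes "invertible P"
  shows "charpoly (P ** B) = charpoly (B ** P)"
proof -
  \<comment> \<open>\<open>c\<close> embeds real matrices as constant matrices over the polynomial ring.\<close>
  define c :: "real^'n^'n \<Rightarrow> real poly^'n^'n" where "c = (\<lambda>M. \<chi> i j. [:M $ i $ j:])"
  have c_mult: "c (M ** N) = c M ** c N" for M N
    by (simp add: c_def matrix_matrix_mult_def vec_eq_iff mult.commute flip: sum_to_poly)
  have c_one: "c (mat 1) = mat 1"
    by (simp add: c_def mat_def vec_eq_iff one_pCons)
  obtain Q where "P ** Q = mat 1"
    using assms by (auto simp: invertible_def)
  then have "det (c P) * det (c Q) = 1"
    by (metis c_mult c_one det_I det_mul)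
  then have nz: "det (c P) \<noteq> 0"
    by auto
  have "(mat [:0, 1:] - c (P ** B)) ** c P = c P ** (mat [:0, 1:] - c (B ** P))"
  proof -
    have "mat x ** M = M ** mat x" for x :: "real poly" and M :: "real poly^'n^'n"
      by (simp add: matrix_matrix_mult_def mat_def vec_eq_iff if_distrib if_distribR mult.commute cong: if_cong)
    moreover have "(M - N) ** R = M ** R - N ** R" "R ** (M - N) = R ** M - R ** N"
      for M N R :: "real poly^'n^'n"
      by (simp_all add: matrix_matrix_mult_def vec_eq_iff algebra_simps sum_subtractf)
    ultimately show ?thesis
      by (simp add: c_mult matrix_mul_assoc)
  qed
  then have "charpoly (P ** B) * det (c P) = det (c P) * charpoly (B ** P)"
    unfolding charpoly_def c_def[symmetric] by (metis c_def det_mul)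
  with nz show ?thesis
    by (simp add: mult.commute)
qed

text \<open>
  For skew \<open>K\<close> the quadratic form \<open>x \<bullet> K x\<close> vanishes, so \<open>x \<bullet> (1 + K) x = x \<bullet> x\<close>.
\<close>
lemma invertible_one_plus_skew:
  fixes K :: "real^'n^'n"
  assumes "transpose K = - K"
  shows "invertible (mat 1 + K)"
proof -
  have "x = 0" if "(mat 1 + K) *v x = 0" for x
  proof -
    have "x \<bullet> (K *v x) = - (x \<bullet> (K *v x))"
    proof -
      have "x \<bullet> (K *v x) = (transpose K *v x) \<bullet> x"
        by (simp add: dot_lmul_matrix)
      also have "\<dots> = - (x \<bullet> (K *v x))"
        by (simp add: assms inner_vec_def matrix_vector_mult_def sum_negf mult.commute)
      finally show ?thesis .
    qed
    then have "x \<bullet> ((mat 1 + K) *v x) = x \<bullet> x"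
      by (simp add: matrix_vector_mult_add_rdistrib inner_add_right)
    with that show "x = 0"
      by simp
  qed
  then show ?thesis
    by (metis invertible_left_inverse matrix_left_invertible_ker)
qed

section \<open>Properties stable under small perturbations\<close>

lemma sgn_entries_stable:
  fixes A :: "real^'n^'n"
  shows "\<exists>\<delta>>0. \<forall>B. norm (B - A) < \<delta> \<longrightarrow> (\<forall>i j. A $ i $ j \<noteq> 0 \<longrightarrow> sgn (B $ i $ j) = sgn (A $ i $ j))"
proof -
  \<comment> \<open>The element \<open>1\<close> only ensures that \<open>S\<close> is nonempty when \<open>A = 0\<close>.\<close>
  define S where "S = insert 1 {\<bar>A $ i $ j\<bar> | i j. A $ i $ j \<noteq> 0}"
  have "{\<bar>A $ i $ j\<bar> | i j. A $ i $ j \<noteq> 0} \<subseteq> (\<lambda>(i, j). \<bar>A $ i $ j\<bar>) ` UNIV"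
    by auto
  then have "finite S"
    unfolding S_def by (meson finite_insert finite_imageI finite finite_subset)
  have "Min S > 0"
    using \<open>finite S\<close> by (subst Min_gr_iff) (auto simp: S_def)
  moreover have "sgn (B $ i $ j) = sgn (A $ i $ j)"
    if "norm (B - A) < Min S" "A $ i $ j \<noteq> 0" for B i j
  proof -
    have "Min S \<le> \<bar>A $ i $ j\<bar>"
      using \<open>finite S\<close> that(2) by (intro Min_le) (auto simp: S_def)
    moreover have "\<bar>B $ i $ j - A $ i $ j\<bar> \<le> norm (B - A)"
      using order_trans[OF Finite_Cartesian_Product.norm_nth_le[where x = "(B - A) $ i" and i = j]
          Finite_Cartesian_Product.norm_nth_le[where x = "B - A" and i = i]] by simp
    ultimately have "\<bar>B $ i $ j - A $ i $ j\<bar> < \<bar>A $ i $ j\<bar>"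
      using that(1) by linarith
    then show ?thesis
      by (auto simp: sgn_if abs_if split: if_splits)
  qed
  ultimately show ?thesis
    by blast
qed

text \<open>
  Let \<open>W\<close> be the space of symmetric \<open>X\<close> with zero diagonal and \<open>A \<circ> X = 0\<close>. An injective
  linear map on \<open>W\<close> is bounded below, and this survives small changes of the map. For \<open>B\<close>
  near \<open>A\<close> the test matrices of \<open>B\<close> lie in \<open>W\<close>, because \<open>B\<close> is nonzero wherever
  \<open>A\<close> is.
\<close>
lemma SSP_open:
  fixes A :: "real^'n^'n"
  assumes "strong_spectral_property A"
  shows "\<exists>\<delta>>0. \<forall>B. symmetric_matrix B \<and> norm (B - A) < \<delta> \<longrightarrow> strong_spectral_property B"
proof -
  interpret mm: bounded_bilinear "(**) :: real^'n^'n \<Rightarrow> real^'n^'n \<Rightarrow> real^'n^'n"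
    by (rule bounded_bilinear_matrix_matrix_mult)
  define W where "W = {X :: real^'n^'n. symmetric_matrix X \<and> A * X = 0 \<and> mat 1 * X = 0}"
  have "subspace W"
    unfolding subspace_def W_def symmetric_matrix_def
    by (auto simp: vec_eq_iff transpose_def) (metis add_0)+
  moreover have "bounded_linear (\<lambda>X. A ** X - X ** A)"
    by (intro bounded_linear_sub mm.bounded_linear_left mm.bounded_linear_right)
  moreover have "\<forall>X\<in>W. A ** X - X ** A = 0 \<longrightarrow> X = 0"
    using assms unfolding W_def strong_spectral_property_def by blast
  ultimately have "\<exists>e>0. \<forall>X\<in>W. norm (A ** X - X ** A) \<ge> e * norm X"
    by (intro injective_imp_isometric closed_subspace)
  then obtain e where "e > 0" and e: "\<And>X. X \<in> W \<Longrightarrow> e * norm X \<le> norm (A ** X - X ** A)"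
    by blast
  have "\<exists>c>0. \<forall>(X :: real^'n^'n) (Y :: real^'n^'n). norm (X ** Y) \<le> norm X * norm Y * c"
    by (rule mm.pos_bounded)
  then obtain c where "c > 0" and c: "norm (X ** Y) \<le> norm X * norm Y * c" for X :: "real^'n^'n" and Y :: "real^'n^'n"
    by auto
  obtain d where "d > 0"
    and d: "\<And>B i j. norm (B - A) < d \<Longrightarrow> A $ i $ j \<noteq> 0 \<Longrightarrow> sgn (B $ i $ j) = sgn (A $ i $ j)"
    using sgn_entries_stable[of A] by blast
  have "strong_spectral_property B"
    if "symmetric_matrix B" "norm (B - A) < min d (e / (2 * c))" for B
    unfolding strong_spectral_property_def
  proof (intro conjI allI impI)
    show "symmetric_matrix B"
      by fact
    fix X :: "real^'n^'n"
    assume X: "symmetric_matrix X \<and> B * X = 0 \<and> mat 1 * X = 0 \<and> B ** X - X ** B = 0"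
    have "A $ i $ j * X $ i $ j = 0" for i j
    proof (cases "A $ i $ j = 0")
      case False
      then have "B $ i $ j \<noteq> 0"
        using d[of B i j] that(2) by (auto simp: sgn_0_0)
      moreover have "B $ i $ j * X $ i $ j = 0"
        using X by (simp add: vec_eq_iff)
      ultimately show ?thesis
        by simp
    qed simp
    then have "X \<in> W"
      using X by (simp add: W_def vec_eq_iff)
    have "A ** X - X ** A = X ** (B - A) - (B - A) ** X"
      using X by (simp add: mm.diff_left mm.diff_right)
    then have "e * norm X \<le> norm (X ** (B - A) - (B - A) ** X)"
      using e[OF \<open>X \<in> W\<close>] by simp
    also have "\<dots> \<le> norm (X ** (B - A)) + norm ((B - A) ** X)"
      by (rule norm_triangle_ineq4)
    also have "\<dots> \<le> 2 * c * norm (B - A) * norm X"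
      using c[of X "B - A"] c[of "B - A" X] by (simp add: algebra_simps)
    finally have "(e - 2 * c * norm (B - A)) * norm X \<le> 0"
      by (simp add: algebra_simps)
    moreover have "e - 2 * c * norm (B - A) > 0"
      using that(2) \<open>c > 0\<close> by (simp add: field_simps)
    ultimately show "X = 0"
      by (simp add: mult_le_0_iff)
  qed
  then show ?thesis
    using \<open>d > 0\<close> \<open>e > 0\<close> \<open>c > 0\<close> by (intro exI[of _ "min d (e / (2 * c))"]) auto
qed

text \<open>
  By homogeneity and the triangle inequality, \<open>N\<close> is controlled by its values on the finitely
  many basis matrices, so a matrix that is small in the Euclidean norm is small for \<open>N\<close>.
\<close>
lemma matrix_norm_bounded:
  assumes "matrix_norm (N :: real^'n^'n \<Rightarrow> real)"
  shows "\<exists>c>0. \<forall>X. N X \<le> c * norm X"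
proof -
  have zero: "N 0 = 0" and nonneg: "\<And>X. N X \<ge> 0"
    and scale: "\<And>r X. N (r *\<^sub>R X) = \<bar>r\<bar> * N X" and tri: "\<And>X Y. N (X + Y) \<le> N X + N Y"
    using assms by (auto simp: matrix_norm_def)
  have sum_le: "N (sum f S) \<le> (\<Sum>b\<in>S. N (f b))" if "finite S" for f and S :: "(real^'n^'n) set"
    using that
  proof (induction S rule: finite_induct)
    case (insert x F)
    then show ?case
      using tri[of "f x" "sum f F"] by simp
  qed (simp add: zero)
  have bound: "N X \<le> (\<Sum>b\<in>Basis. N b) * norm X" for X
  proof -
    have "N X = N (\<Sum>b\<in>Basis. (X \<bullet> b) *\<^sub>R b)"
      by (simp add: euclidean_representation)
    also have "\<dots> \<le> (\<Sum>b\<in>Basis. N ((X \<bullet> b) *\<^sub>R b))"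
      by (rule sum_le) simp
    also have "\<dots> \<le> (\<Sum>b\<in>Basis. N b * norm X)"
      by (intro sum_mono) (simp add: scale mult.commute Basis_le_norm mult_left_mono nonneg)
    finally show ?thesis
      by (simp add: sum_distrib_right)
  qed
  have "N X \<le> (1 + (\<Sum>b\<in>Basis. N b)) * norm X" for X
    using bound[of X] by (simp add: distrib_right add_increasing)
  moreover have "1 + (\<Sum>b\<in>Basis. N b) > 0"
    by (simp add: add_pos_nonneg sum_nonneg nonneg)
  ultimately show ?thesis
    by blast
qed

section \<open>Solving for the perturbed matrix\<close>

text \<open>
  The zero entries of \<open>A\<close> off the diagonal can be prescribed freely, as long as the new values are
  small and symmetric, at the cost of a small change of the remaining entries.
\<close>
lemma SSP_isospectral_perturbation:
  fixes A :: "real^'n^'n"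
  assumes SSP: "strong_spectral_property A" and "\<delta> > 0"
  shows "\<exists>\<eta>>0. \<forall>T. symmetric_matrix T \<and> norm T < \<eta> \<longrightarrow>
    (\<exists>A'. symmetric_matrix A' \<and> charpoly A' = charpoly A \<and> norm (A' - A) < \<delta> \<and>
      (\<forall>i j. i \<noteq> j \<and> A $ i $ j = 0 \<longrightarrow> A' $ i $ j = T $ i $ j))"
proof -
  interpret mm: bounded_bilinear "(**) :: real^'n^'n \<Rightarrow> real^'n^'n \<Rightarrow> real^'n^'n"
    by (rule bounded_bilinear_matrix_matrix_mult)
  \<comment> \<open>A point \<open>p\<close> is a triple \<open>(L, C, B)\<close>, and \<open>K = antisymmetrize L\<close>. The map
      \<open>iso\<close> is the candidate for \<open>A'\<close>; it is similar to the first component of \<open>F\<close>.\<close>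
  define iso where "iso = (\<lambda>p :: (real^'n^'n) \<times> (real^'n^'n) \<times> (real^'n^'n).
    (mat 1 - antisymmetrize (fst p)) ** fst (snd p) ** (mat 1 + antisymmetrize (fst p)))"
  define F where "F = (\<lambda>p. ((mat 1 + antisymmetrize (fst p)) ** fst (snd p) ** (mat 1 - antisymmetrize (fst p)),
    iso p + pattern_part A (snd (snd p))))"
  define F' where "F' = (\<lambda>p :: (real^'n^'n) \<times> (real^'n^'n) \<times> (real^'n^'n).
    (fst (snd p) + antisymmetrize (fst p) ** A - A ** antisymmetrize (fst p),
     fst (snd p) - antisymmetrize (fst p) ** A + A ** antisymmetrize (fst p) + pattern_part A (snd (snd p))))"
  define p0 :: "(real^'n^'n) \<times> (real^'n^'n) \<times> (real^'n^'n)" where "p0 = (0, A, 0)"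
  have blin: "bounded_linear antisymmetrize" "bounded_linear (pattern_part A)"
    by (simp_all add: linear_antisymmetrize linear_pattern_part flip: linear_conv_bounded_linear)
  note zeros [simp] = linear_0[OF linear_antisymmetrize] linear_0[OF linear_pattern_part]
  have cont_iso: "continuous_on UNIV iso"
    unfolding iso_def by (intro continuous_intros bounded_linear.continuous_on[OF blin(1)])
  have cont: "continuous_on UNIV F"
    unfolding F_def
    by (intro continuous_intros bounded_linear.continuous_on[OF blin(1)]
        bounded_linear.continuous_on[OF blin(2)] cont_iso)
  have deriv: "(F has_derivative F') (at p0)"
    unfolding F_def F'_def iso_def
    by (rule has_derivative_eq_rhs,
        (rule derivative_intros bounded_linear.has_derivative[OF blin(1)] bounded_linear.has_derivative[OF blin(2)])+)
      (auto simp: p0_def mm.diff_left mm.diff_right mm.add_left mm.add_right mm.minus_left mm.minus_right fun_eq_iff)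
  have "linear F'"
    using deriv by (rule has_derivative_linear)
  moreover have "surj F'"
  proof -
    have "\<exists>p. (U, V) = F' p" for U V
    proof -
      obtain L B where LB: "A ** antisymmetrize L - antisymmetrize L ** A + pattern_part A B = V - U"
        using SSP_commutator_plus_pattern_surj[OF SSP] by blast
      \<comment> \<open>The choice of \<open>C\<close> below makes the first component equal to \<open>U\<close>, and this doubles
          the commutator in the second one: hence the factor 1/2.\<close>
      define K where "K = (1/2) *\<^sub>R antisymmetrize L"
      have K: "antisymmetrize ((1/2) *\<^sub>R L) = K" and "antisymmetrize L = K + K"
        by (simp_all add: K_def linear_scale[OF linear_antisymmetrize] flip: scaleR_add_left)
      then have "V = U + (A ** K + A ** K) - (K ** A + K ** A) + pattern_part A B"
        using LB unfolding \<open>antisymmetrize L = K + K\<close> mm.add_left mm.add_right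
        by (simp only: algebra_simps)
      then have "(U, V) = F' ((1/2) *\<^sub>R L, U - K ** A + A ** K, B)"
        by (simp add: F'_def K)
      then show ?thesis ..
    qed
    then show ?thesis
      by (auto simp: surj_def)
  qed
  ultimately obtain g where "linear g" "F' \<circ> g = id"
    using linear_surjective_right_inverse by blast
  define S where "S = {p. norm (iso p - A) < \<delta>}"
  have "open S"
    unfolding S_def by (intro open_Collect_less continuous_intros cont_iso)
  moreover have "p0 \<in> S"
    using \<open>\<delta> > 0\<close> by (simp add: S_def iso_def p0_def)
  ultimately have "F p0 \<in> interior (F ` S)"
    using sussmann_open_mapping[OF open_UNIV cont UNIV_I deriv _ \<open>F' \<circ> g = id\<close>, of S] \<open>linear g\<close>
    by (simp add: linear_conv_bounded_linear interior_open)
  moreover have "F p0 = (A, A)"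
    by (simp add: F_def iso_def p0_def)
  ultimately obtain \<eta> where "\<eta> > 0" and \<eta>: "ball (A, A) \<eta> \<subseteq> F ` S"
    by (auto simp: mem_interior)
  have "\<exists>A'. symmetric_matrix A' \<and> charpoly A' = charpoly A \<and> norm (A' - A) < \<delta> \<and>
      (\<forall>i j. i \<noteq> j \<and> A $ i $ j = 0 \<longrightarrow> A' $ i $ j = T $ i $ j)"
    if T: "symmetric_matrix T" "norm T < \<eta>" for T
  proof -
    have "(A, A + T) \<in> ball (A, A) \<eta>"
      using T by (simp add: dist_Pair_Pair dist_norm)
    then obtain p where "p \<in> S" "F p = (A, A + T)"
      using \<eta> by (metis (no_types, lifting) imageE subsetD)
    obtain L C B where p: "p = (L, C, B)"
      by (cases p)
    define K where "K = antisymmetrize L"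
    define M where "M = mat 1 + K"
    define N where "N = mat 1 - K"
    define A' where "A' = N ** C ** M"
    have A: "A = M ** C ** N" and A': "A' + pattern_part A B = A + T" and "norm (A' - A) < \<delta>"
      using \<open>p \<in> S\<close> \<open>F p = (A, A + T)\<close> by (auto simp: F_def S_def iso_def p K_def M_def N_def A'_def)
    have skew: "transpose K = - K"
      by (simp add: K_def transpose_antisymmetrize)
    have tM: "transpose M = N" and tN: "transpose N = M"
      by (simp_all add: M_def N_def transpose_add transpose_diff skew)
    have "invertible M" "invertible N"
      using invertible_one_plus_skew[OF skew] invertible_one_plus_skew[of "- K"]
      by (simp_all add: M_def N_def transpose_minus skew)
    have MN: "M ** N = N ** M"
      by (simp add: M_def N_def mm.add_left mm.add_right mm.diff_left mm.diff_right)
    have symA: "symmetric_matrix A"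
      using SSP by (simp add: strong_spectral_property_def)
    have "M ** transpose C ** N = M ** C ** N"
      using symA unfolding symmetric_matrix_def A
      by (simp add: matrix_transpose_mul tM tN matrix_mul_assoc)
    \<comment> \<open>\<open>C\<close> ranged over all matrices; it is symmetric because \<open>M C N\<close> determines it.\<close>
    moreover obtain M' N' where "M' ** M = mat 1" "N ** N' = mat 1"
      using \<open>invertible M\<close> \<open>invertible N\<close> by (auto simp: invertible_def)
    then have "M' ** (M ** X ** N) ** N' = X" for X
      by (metis matrix_mul_assoc matrix_mul_lid matrix_mul_rid)
    ultimately have "transpose C = C"
      by metis
    then have symA': "symmetric_matrix A'"
      by (simp add: symmetric_matrix_def A'_def matrix_transpose_mul tM tN matrix_mul_assoc)
    \<comment> \<open>Both \<open>A\<close> and \<open>A'\<close> are similar to \<open>C M N\<close>, since \<open>M\<close> and \<open>N\<close> commute.\<close>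
    have "charpoly A' = charpoly (C ** (M ** N))"
      using charpoly_mult_commute[OF \<open>invertible N\<close>, of "C ** M"]
      by (simp add: A'_def matrix_mul_assoc)
    moreover have "charpoly A = charpoly (C ** (N ** M))"
      using charpoly_mult_commute[OF \<open>invertible M\<close>, of "C ** N"]
      by (simp add: A matrix_mul_assoc)
    ultimately have "charpoly A' = charpoly A"
      by (simp add: MN)
    have "A' $ i $ j = T $ i $ j" if "i \<noteq> j" "A $ i $ j = 0" for i j
    proof -
      have eq: "pattern_part A B = A + T - A'"
        using A' by (simp add: algebra_simps)
      have "symmetric_matrix (pattern_part A B)"
        using symA symA' T(1) unfolding eq by (simp add: symmetric_matrix_def vec_eq_iff transpose_def)
      then have "pattern_part A B $ i $ j = 0"
        using symmetric_pattern_part_zero[OF symA _ that] by simp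
      then show ?thesis
        by (simp add: eq that)
    qed
    with symA' \<open>charpoly A' = charpoly A\<close> \<open>norm (A' - A) < \<delta>\<close> show ?thesis
      by blast
  qed
  with \<open>\<eta> > 0\<close> show ?thesis
    by blast
qed

section \<open>Supergraphs with prescribed signs\<close>

theorem theorem3p3:
  fixes G H :: "'n::finite set set"
    and A :: "real^'n^'n"
    and N :: "real^'n^'n \<Rightarrow> real"
    and \<epsilon> :: real
    and \<sigma> :: "'n set \<Rightarrow> real"
  assumes "simple_graph G"
    and "spanning_supergraph H G"
    and "A \<in> graph_matrices G"
    and "strong_spectral_property A"
    and "matrix_norm N"
    and "\<epsilon> > 0"
    and "\<sigma> \<in> (H - G) \<rightarrow> {1, -1}"
  shows "\<exists>A' \<in> graph_matrices H.
      spec A' = spec A \<and>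
      strong_spectral_property A' \<and>
      N (A' - A) < \<epsilon> \<and>
      (\<forall>i j. {i, j} \<in> H - G \<longrightarrow> sgn (A' $ i $ j) = \<sigma> {i, j}) \<and>
      (\<forall>i j. i \<noteq> j \<and> {i, j} \<notin> H - G \<longrightarrow> sgn (A' $ i $ j) = sgn (A $ i $ j))"
proof -
  have SSP: "strong_spectral_property A"
    by fact
  have symA: "symmetric_matrix A"
    and A_edge: "\<And>i j. i \<noteq> j \<Longrightarrow> A $ i $ j \<noteq> 0 \<longleftrightarrow> {i, j} \<in> G"
    using \<open>A \<in> graph_matrices G\<close> by (auto simp: graph_matrices_def)
  have neq: "i \<noteq> j" if "{i, j} \<in> H" for i j
    using \<open>spanning_supergraph H G\<close> that by (auto simp: spanning_supergraph_def simple_graph_def)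
  have "G \<subseteq> H"
    using \<open>spanning_supergraph H G\<close> by (simp add: spanning_supergraph_def)
  obtain d1 where "d1 > 0" and d1: "\<forall>B. norm (B - A) < d1 \<longrightarrow>
      (\<forall>i j. A $ i $ j \<noteq> 0 \<longrightarrow> sgn (B $ i $ j) = sgn (A $ i $ j))"
    using sgn_entries_stable[of A] by auto
  obtain d2 where "d2 > 0"
    and d2: "\<forall>B. symmetric_matrix B \<and> norm (B - A) < d2 \<longrightarrow> strong_spectral_property B"
    using SSP_open[OF SSP] by auto
  obtain c where "c > 0" and c: "\<forall>X. N X \<le> c * norm X"
    using matrix_norm_bounded[OF \<open>matrix_norm N\<close>] by auto
  define \<delta> where "\<delta> = min d1 (min d2 (\<epsilon> / c))"
  have "\<delta> > 0" using \<open>d1 > 0\<close> \<open>d2 > 0\<close> \<open>c > 0\<close> \<open>\<epsilon> > 0\<close> by (simp add: \<delta>_def)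
  obtain \<eta> where "\<eta> > 0" and \<eta>: "\<forall>T. symmetric_matrix T \<and> norm T < \<eta> \<longrightarrow>
    (\<exists>A'. symmetric_matrix A' \<and> charpoly A' = charpoly A \<and> norm (A' - A) < \<delta> \<and>
      (\<forall>i j. i \<noteq> j \<and> A $ i $ j = 0 \<longrightarrow> A' $ i $ j = T $ i $ j))"
    using SSP_isospectral_perturbation[OF SSP \<open>\<delta> > 0\<close>] by auto
  define T1 :: "real^'n^'n" where "T1 = (\<chi> i j. if {i, j} \<in> H - G then \<sigma> {i, j} else 0)"
  define t where "t = \<eta> / (norm T1 + 1)"
  have "norm T1 + 1 > 0"
    by (rule add_nonneg_pos) simp_all
  then have "t > 0"
    using \<open>\<eta> > 0\<close> by (simp add: t_def)
  have T_sym: "symmetric_matrix (t *\<^sub>R T1)"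
    by (simp add: symmetric_matrix_def vec_eq_iff transpose_def T1_def insert_commute)
  have T_small: "norm (t *\<^sub>R T1) < \<eta>"
  proof -
    have "t * norm T1 < t * (norm T1 + 1)"
      using \<open>t > 0\<close> by simp
    also have "\<dots> = \<eta>"
      unfolding t_def using \<open>norm T1 + 1 > 0\<close>
      by (intro nonzero_eq_divide_eq[THEN iffD1] refl less_imp_neq[symmetric])
    finally show ?thesis
      using \<open>t > 0\<close> by simp
  qed
  obtain A' where symA': "symmetric_matrix A'" and char: "charpoly A' = charpoly A"
    and near: "norm (A' - A) < \<delta>"
    and off: "\<And>i j. i \<noteq> j \<Longrightarrow> A $ i $ j = 0 \<Longrightarrow> A' $ i $ j = (t *\<^sub>R T1) $ i $ j"
    using \<eta>[rule_format, OF conjI[OF T_sym T_small]] by (elim exE conjE) simp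
  have new: "sgn (A' $ i $ j) = \<sigma> {i, j}" if "{i, j} \<in> H - G" for i j
  proof -
    have "A' $ i $ j = t * \<sigma> {i, j}"
      using off[of i j] A_edge[of i j] neq[of i j] that by (simp add: T1_def)
    moreover have "\<sigma> {i, j} \<in> {1, -1}"
      using \<open>\<sigma> \<in> (H - G) \<rightarrow> {1, -1}\<close> that by blast
    ultimately show ?thesis
      using \<open>t > 0\<close> by (auto simp: sgn_mult)
  qed
  have old: "sgn (A' $ i $ j) = sgn (A $ i $ j)" if "i \<noteq> j" "{i, j} \<notin> H - G" for i j
  proof (cases "A $ i $ j = 0")
    case True
    then show ?thesis
      using off[of i j] that by (auto simp: T1_def)
  next
    case False
    then show ?thesis
      using d1 near by (simp add: \<delta>_def)
  qed
  have "A' $ i $ j \<noteq> 0 \<longleftrightarrow> {i, j} \<in> H" if "i \<noteq> j" for i j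
  proof (cases "{i, j} \<in> H - G")
    case True
    then have "sgn (A' $ i $ j) \<in> {1, -1}"
      using new \<open>\<sigma> \<in> (H - G) \<rightarrow> {1, -1}\<close> by (metis Pi_mem)
    with True show ?thesis
      by auto
  next
    case False
    then have "A' $ i $ j \<noteq> 0 \<longleftrightarrow> A $ i $ j \<noteq> 0"
      using old[OF that] by (metis sgn_zero_iff)
    with False show ?thesis
      using A_edge[OF that] \<open>G \<subseteq> H\<close> by auto
  qed
  then have "A' \<in> graph_matrices H"
    using symA' by (simp add: graph_matrices_def)
  moreover have "spec A' = spec A"
    by (simp add: spec_def char)
  moreover have "strong_spectral_property A'"
    using d2 symA' near by (simp add: \<delta>_def)
  moreover have "N (A' - A) < \<epsilon>"
  proof -
    have "N (A' - A) \<le> c * norm (A' - A)"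
      using c by blast
    also have "\<dots> < \<epsilon>"
      using near \<open>c > 0\<close> by (simp add: \<delta>_def field_simps)
    finally show ?thesis .
  qed
  ultimately show ?thesis
    using new old by (intro bexI[of _ A'] conjI allI impI) auto
qed

end
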